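(* For almost every initial datum $(\mathbf{x},\mathbf{v})\in\mathbb{T}^{nN}\times\mathbb{R}^{nN}$, the $N$ particles evolving by the sticky particle dynamics with communication range $r_0>0$ congregate in a single cluster. Hence the Generic Alignment Conjecture holds for this model: for almost every initial datum the velocities align, $\max_{i,j}|v_i-v_j|\to0$ as $t\to\infty$.
   Context: Here $\mathbb{T}^n$ is the $2\pi$-periodic torus, $\mathbf{x}=(x_1,\dots,x_N)$ with $x_i\in\mathbb{T}^n$ are the positions of the agents (particles), and $\mathbf{v}=(v_1,\dots,v_N)$ with $v_i\in\mathbb{R}^n$ are their velocities. "Almost every" refers to Lebesgue measure on $\mathbb{T}^{nN}\times\mathbb{R}^{nN}$. The sticky particle model formally corresponds to the Cucker-Smale system $\dot x_i=v_i$, $\dot v_i=\frac1N\sum_{j=1}^N\phi(x_i-x_j)(v_j-v_i)$ with infinitely strong local communication, $\phi(x)=\infty$ for $|x|\le r_0$ and $\phi(x)=0$ for $|x|>r_0$. Its dynamics obeys the following rules; between collisions, agents and clusters travel with constant velocity. (a) If two agents $x_i,x_j$ approach distance $r_0$, their velocities switch instantaneously to the average $\frac12(v_i+v_j)$, and from that point on the agents are stuck together for the rest of the time. (b) More generally, clusters $\mathcal{C}^1,\dots,\mathcal{C}^K$, where $\mathcal{C}^k$ consists of the particles $x_i^k$, $i=1,\dots,I_k$ (so $I_k$ is the number of particles in $\mathcal{C}^k$), are said to collide at time $t^*$ if for all $t<t^*$ one has $|x_i^k-x_j^l|>r_0$ for all $i,j$ and all $k\ne l$, and at $t=t^*$ for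 each pair $k\ne l$ there exist $i,j$ such that $|x_i^k-x_j^l|=r_0$. If the clusters have been traveling with velocities $v^1,\dots,v^K$, respectively, then at time $t^*$ a new cluster is formed, traveling with velocity $$v=\frac{1}{I_1+\dots+I_K}\sum_{k=1}^K I_k\,v^k .$$ *)

theory Defs
  imports "HOL-Analysis.Analysis"
begin

text \<open>
  The torus is represented by its universal cover: a position is a vector in \<open>real ^ 'n\<close>, read
  modulo the lattice of periods. The agents are indexed by the finite type \<open>'N\<close>.
\<close>

definition torus_periods :: "(real ^ 'n) set" where
  "torus_periods = {z. \<forall>k. \<exists>m::int. z $ k = 2 * pi * of_int m}"

definition torus_dist :: "real ^ 'n \<Rightarrow> real ^ 'n \<Rightarrow> real" where
  "torus_dist a b = infdist (a - b) torus_periods"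

text \<open>
  Each point of the torus has exactly one representative in the cell \<open>[0, 2 pi)^n\<close>; Lebesgue measure
  on the torus is Lebesgue measure on this cell.
\<close>

definition initial_data :: "((real ^ 'n ^ 'N) \<times> (real ^ 'n ^ 'N)) set" where
  "initial_data = {x. \<forall>i k. x $ i $ k \<in> {0..<2 * pi}} \<times> UNIV"

definition clusters_touch :: "real \<Rightarrow> real ^ 'n ^ 'N \<Rightarrow> 'N set \<Rightarrow> 'N set \<Rightarrow> bool" where
  "clusters_touch r x A B \<longleftrightarrow> (\<exists>i\<in>A. \<exists>j\<in>B. torus_dist (x $ i) (x $ j) \<le> r)"

text \<open>
  Clusters that touch stick together, so clusters linked by a chain of touching ones form a single
  cluster. If the clusters of a chain touch pairwise, this is the collision of \<open>K\<close> clusters; the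
  chain covers simultaneous collisions that share a cluster.
\<close>

definition merged_clusters :: "real \<Rightarrow> real ^ 'n ^ 'N \<Rightarrow> 'N set set \<Rightarrow> 'N set set" where
  "merged_clusters r x P =
     (\<lambda>A. \<Union> {B. (A, B) \<in> {(C, D). C \<in> P \<and> D \<in> P \<and> clusters_touch r x C D}\<^sup>*}) ` P"

text \<open>
  \<open>P\<close> and \<open>v\<close> are the clusters and the velocities of the agents just before the current time, \<open>P'\<close>
  and \<open>v'\<close> those from the current time on, and \<open>x\<close> are the current positions; \<open>u C\<close> is the common
  velocity of the agents of the cluster \<open>C\<close>. If no two different clusters touch, nothing changes.
\<close>

definition sticky_collision ::
  "real \<Rightarrow> real ^ 'n ^ 'N \<Rightarrow> 'N set set \<Rightarrow> real ^ 'n ^ 'N \<Rightarrow> 'N set set \<Rightarrow> real ^ 'n ^ 'N \<Rightarrow> bool" where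
  "sticky_collision r x P v P' v' \<longleftrightarrow>
     P' = merged_clusters r x P \<and>
     (\<exists>u. (\<forall>C\<in>P. \<forall>i\<in>C. v $ i = u C) \<and>
          (\<forall>D\<in>P'. \<forall>i\<in>D. v' $ i =
             (1 / real (\<Sum>C | C \<in> P \<and> C \<subseteq> D. card C)) *\<^sub>R
             (\<Sum>C | C \<in> P \<and> C \<subseteq> D. real (card C) *\<^sub>R u C)))"

text \<open>
  \<open>X t\<close>, \<open>V t\<close> and \<open>P t\<close> are the positions, the velocities and the clusters at time \<open>t \<ge> 0\<close>; all three
  are unconstrained for \<open>t < 0\<close>. Initially each agent is a cluster of its own, and agents that start
  within distance \<open>r\<close> of one another stick together at time 0, as the communication kernel is
  infinite on \<open>|x| \<le> r\<close>. \<open>V\<close> and \<open>P\<close> are right continuous, so \<open>V 0\<close> is the velocity after this initial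
  clustering. The last two conjuncts say that the agents move freely in some interval to the right of
  each time and in some interval to its left, and that the collision rule links these two.
\<close>

definition sticky_evolution ::
  "real \<Rightarrow> real ^ 'n ^ 'N \<Rightarrow> real ^ 'n ^ 'N \<Rightarrow>
   (real \<Rightarrow> real ^ 'n ^ 'N) \<Rightarrow> (real \<Rightarrow> real ^ 'n ^ 'N) \<Rightarrow> (real \<Rightarrow> 'N set set) \<Rightarrow> bool" where
  "sticky_evolution r x v X V P \<longleftrightarrow>
     X 0 = x \<and>
     sticky_collision r x (range (\<lambda>i. {i})) v (P 0) (V 0) \<and>
     (\<forall>t\<ge>0. \<exists>e>t. \<forall>s\<in>{t..<e}. P s = P t \<and> V s = V t \<and> X s = X t + (s - t) *\<^sub>R V t) \<and>
     (\<forall>t>0. \<exists>s\<in>{0..<t}.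
        (\<forall>w\<in>{s..<t}. P w = P s \<and> V w = V s) \<and>
        (\<forall>w\<in>{s..t}. X w = X s + (w - s) *\<^sub>R V s) \<and>
        sticky_collision r (X t) (P s) (V s) (P t) (V t))"

end

theory Submission
  imports Defs "HOL-Analysis.Kronecker_Approximation_Theorem"
begin

text \<open>
  Collisions conserve momentum, so at every time the velocity of a cluster is the mean of the
  initial velocities of its agents. The number of clusters does not increase, hence is eventually
  constant, and from then on all clusters move freely without touching. If two clusters were left,
  their relative velocity would be a difference of means of the initial velocities over two disjoint
  sets of agents. Outside a countable union of hyperplanes its components are linearly independent
  over the integers, so by Kronecker's theorem the relative motion is dense on the torus and the
  clusters touch, a contradiction.
\<close>

section \<open>Merging clusters\<close>

text \<open>Names the relation that \<open>merged_clusters\<close> writes inline, so that its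
  closure can be studied on its own.\<close>

definition touch_rel :: "real \<Rightarrow> real ^ 'n ^ 'N \<Rightarrow> 'N set set \<Rightarrow> ('N set \<times> 'N set) set" where
  "touch_rel r x P = {(C, D). C \<in> P \<and> D \<in> P \<and> clusters_touch r x C D}"

definition merged_cluster :: "real \<Rightarrow> real ^ 'n ^ 'N \<Rightarrow> 'N set set \<Rightarrow> 'N set \<Rightarrow> 'N set" where
  "merged_cluster r x P A = \<Union> ((touch_rel r x P)\<^sup>* `` {A})"

text \<open>These are exactly the fixed points of \<open>merged_clusters\<close>: the configurations
  in which the collision rule changes nothing.\<close>

definition separated :: "real \<Rightarrow> real ^ 'n ^ 'N \<Rightarrow> 'N set set \<Rightarrow> bool" where
  "separated r x P \<longleftrightarrow> (\<forall>A\<in>P. \<forall>B\<in>P. clusters_touch r x A B \<longrightarrow> A = B)"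

lemma merged_clusters_eq_image: "merged_clusters r x P = merged_cluster r x P ` P"
  unfolding merged_clusters_def merged_cluster_def touch_rel_def by (simp add: Image_def)

lemma torus_periods_minus: "z \<in> torus_periods \<Longrightarrow> - z \<in> torus_periods"
  unfolding torus_periods_def by (simp, metis of_int_minus mult_minus_right)

lemma zero_mem_torus_periods: "0 \<in> torus_periods"
  unfolding torus_periods_def by (auto intro: exI[of _ 0])

text \<open>The lattice of periods is symmetric about 0, so negation preserves the distance to it.
  The single inequality \<open>le\<close> suffices, used for \<open>a - b\<close> and for
  \<open>b - a\<close>.\<close>

lemma torus_dist_commute: "torus_dist a b = torus_dist b a"
proof -
  have le: "infdist z torus_periods \<le> infdist (- z) torus_periods" for z :: "real ^ 'n"
  proof -
    have ne: "(torus_periods :: (real ^ 'n) set) \<noteq> {}"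
      using zero_mem_torus_periods by blast
    have "infdist z torus_periods \<le> dist (- z) p" if "p \<in> torus_periods" for p
      using infdist_le[OF torus_periods_minus[OF that], of z]
      by (simp add: dist_norm norm_minus_commute add.commute)
    then show ?thesis using ne by (subst (2) infdist_notempty) (auto intro: cINF_greatest)
  qed
  show ?thesis using le[of "a - b"] le[of "b - a"] by (simp add: torus_dist_def)
qed

text \<open>With symmetry the closure of touching is an equivalence, and a merged cluster is the
  union of one of its classes.\<close>

lemma sym_touch_rel: "sym (touch_rel r x P)"
proof -
  have "clusters_touch r x B A" if "clusters_touch r x A B" for A B
  proof -
    from that obtain i j where "i \<in> A" "j \<in> B" "torus_dist (x $ i) (x $ j) \<le> r"
      unfolding clusters_touch_def by blast
    then show ?thesis
      unfolding clusters_touch_def torus_dist_commute[of "x $ i"] by blast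
  qed
  then show ?thesis by (auto simp: touch_rel_def sym_def)
qed

lemma touch_rtrancl_mem: "(A, B) \<in> (touch_rel r x P)\<^sup>* \<Longrightarrow> A \<in> P \<Longrightarrow> B \<in> P"
  by (induction rule: rtrancl_induct) (auto simp: touch_rel_def)

lemma merged_cluster_cong:
  assumes "(A, B) \<in> (touch_rel r x P)\<^sup>*"
  shows "merged_cluster r x P A = merged_cluster r x P B"
proof -
  have "(B, A) \<in> (touch_rel r x P)\<^sup>*"
    using assms sym_rtrancl[OF sym_touch_rel] by (meson symD)
  with assms have "(touch_rel r x P)\<^sup>* `` {A} = (touch_rel r x P)\<^sup>* `` {B}"
    by (auto intro: rtrancl_trans)
  then show ?thesis by (simp add: merged_cluster_def)
qed

lemma subset_merged_cluster: "A \<subseteq> merged_cluster r x P A"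
  unfolding merged_cluster_def by auto

text \<open>An agent lies in only one cluster of a partition, so the linked cluster that contributes
  \<open>i\<close> must be \<open>B\<close>. This turns statements about agents into statements
  about links.\<close>

lemma merged_cluster_meets:
  assumes "partition_on UNIV P" "A \<in> P" "B \<in> P" "i \<in> B" "i \<in> merged_cluster r x P A"
  shows "(A, B) \<in> (touch_rel r x P)\<^sup>*"
proof -
  from assms(5) obtain C where C: "(A, C) \<in> (touch_rel r x P)\<^sup>*" "i \<in> C"
    by (auto simp: merged_cluster_def)
  then have "C \<in> P" using touch_rtrancl_mem assms(2) by metis
  then have "C = B" using assms C partition_onD2[OF assms(1)] by (auto simp: disjoint_def)
  with C show ?thesis by simp
qed

lemma partition_on_UNIV_E:
  assumes "partition_on UNIV P"
  obtains C where "C \<in> P" "i \<in> C"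
  using partition_onD1[OF assms] UNIV_I[of i] by (metis UnionE)

lemma partition_on_merged:
  assumes P: "partition_on UNIV P"
  shows "partition_on UNIV (merged_clusters r x P)"
proof (rule partition_onI)
  show "\<Union> (merged_clusters r x P) = UNIV"
  proof -
    have "UNIV \<subseteq> \<Union> P" using partition_onD1[OF P] by simp
    also have "\<dots> \<subseteq> \<Union> (merged_clusters r x P)"
      unfolding merged_clusters_eq_image by (rule UN_mono[of P P id, simplified]) (rule subset_merged_cluster)
    finally show ?thesis by blast
  qed
  show "{} \<notin> merged_clusters r x P"
  proof
    assume "{} \<in> merged_clusters r x P"
    then obtain A where "A \<in> P" "merged_cluster r x P A = {}"
      by (auto simp: merged_clusters_eq_image)
    with subset_merged_cluster[of A r x P] partition_onD3[OF P] show False by simp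
  qed
  fix D E assume DE: "D \<in> merged_clusters r x P" "E \<in> merged_clusters r x P" "D \<noteq> E"
  then obtain A B where AB: "A \<in> P" "B \<in> P" "D = merged_cluster r x P A" "E = merged_cluster r x P B"
    by (auto simp: merged_clusters_eq_image)
  show "disjnt D E"
  proof (rule ccontr)
    assume "\<not> disjnt D E"
    then obtain i where i: "i \<in> D" "i \<in> E" by (auto simp: disjnt_def)
    \<comment> \<open>The old cluster of a shared agent is linked to both \<open>A\<close> and
      \<open>B\<close>, so their merged clusters coincide.\<close>
    obtain C where "C \<in> P" "i \<in> C" by (rule partition_on_UNIV_E[OF P])
    with i AB have "(A, C) \<in> (touch_rel r x P)\<^sup>*" "(B, C) \<in> (touch_rel r x P)\<^sup>*"
      by (auto intro: merged_cluster_meets[OF P, of _ _ i])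
    then have "merged_cluster r x P A = merged_cluster r x P B"
      by (metis merged_cluster_cong)
    with AB DE(3) show False by simp
  qed
qed

text \<open>Touching merged clusters contain touching old ones, and those were already linked. So
  one merging settles all contacts at the given positions.\<close>

lemma separated_merged:
  assumes P: "partition_on UNIV P"
  shows "separated r x (merged_clusters r x P)"
  unfolding separated_def
proof (intro ballI impI)
  fix D E assume DE: "D \<in> merged_clusters r x P" "E \<in> merged_clusters r x P" "clusters_touch r x D E"
  then obtain A B where AB: "A \<in> P" "B \<in> P" "D = merged_cluster r x P A" "E = merged_cluster r x P B"
    by (auto simp: merged_clusters_eq_image)
  from DE(3) obtain i j where ij: "i \<in> D" "j \<in> E" "torus_dist (x $ i) (x $ j) \<le> r"
    by (auto simp: clusters_touch_def)
  obtain A' where A': "A' \<in> P" "i \<in> A'" by (rule partition_on_UNIV_E[OF P])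
  obtain B' where B': "B' \<in> P" "j \<in> B'" by (rule partition_on_UNIV_E[OF P])
  have "(A', B') \<in> (touch_rel r x P)\<^sup>*"
    using A' B' ij by (auto simp: touch_rel_def clusters_touch_def)
  moreover have "(A, A') \<in> (touch_rel r x P)\<^sup>*" "(B, B') \<in> (touch_rel r x P)\<^sup>*"
    using A' B' ij AB by (auto intro: merged_cluster_meets[OF P, of _ _ i] merged_cluster_meets[OF P, of _ _ j])
  ultimately show "D = E" unfolding AB by (metis merged_cluster_cong)
qed

lemma merged_cluster_separated:
  assumes "separated r x P" "A \<in> P"
  shows "merged_cluster r x P A = A"
proof -
  have "B = A" if "(A, B) \<in> (touch_rel r x P)\<^sup>*" for B
    using that by (induction rule: rtrancl_induct) (use assms in \<open>auto simp: touch_rel_def separated_def\<close>)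
  then show ?thesis by (auto simp: merged_cluster_def)
qed

lemma merged_clusters_separated: "separated r x P \<Longrightarrow> merged_clusters r x P = P"
  by (simp add: merged_clusters_eq_image merged_cluster_separated)

lemma card_merged_le: "card (merged_clusters r x P) \<le> card P"
  for P :: "'N::finite set set"
  by (simp add: merged_clusters_eq_image card_image_le)

text \<open>By finiteness an unchanged count makes \<open>merged_cluster\<close> injective on
  \<open>P\<close>, whereas touching clusters have the same image. Thus the number of clusters
  detects collisions.\<close>

lemma separated_if_card_merged_eq:
  fixes P :: "'N::finite set set"
  assumes "card (merged_clusters r x P) = card P"
  shows "separated r x P"
  unfolding separated_def
proof (intro ballI impI)
  fix A B assume AB: "A \<in> P" "B \<in> P" "clusters_touch r x A B"
  then have "(A, B) \<in> (touch_rel r x P)\<^sup>*" by (auto simp: touch_rel_def)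
  then have "merged_cluster r x P A = merged_cluster r x P B" by (rule merged_cluster_cong)
  moreover have "inj_on (merged_cluster r x P) P"
    using assms by (auto simp: merged_clusters_eq_image intro: eq_card_imp_inj_on)
  ultimately show "A = B" using AB by (auto dest: inj_onD)
qed

section \<open>Conservation of momentum\<close>

definition cluster_mean :: "real ^ 'n ^ 'N \<Rightarrow> 'N set \<Rightarrow> real ^ 'n" where
  "cluster_mean v C = (1 / real (card C)) *\<^sub>R (\<Sum>i\<in>C. v $ i)"

text \<open>The invariant of the evolution, with \<open>v0\<close> the initial velocities: momentum
  is conserved within each cluster, so the velocities are a function of the partition alone.\<close>

definition moves_with_mean :: "real ^ 'n ^ 'N \<Rightarrow> 'N set set \<Rightarrow> real ^ 'n ^ 'N \<Rightarrow> bool" where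
  "moves_with_mean v0 P v \<longleftrightarrow>
     partition_on UNIV P \<and> (\<forall>C\<in>P. \<forall>i\<in>C. v $ i = cluster_mean v0 C)"

lemma moves_with_mean_unique:
  assumes "moves_with_mean v0 P v" "moves_with_mean v0 P w"
  shows "v = w"
proof -
  have "v $ i = w $ i" for i
  proof -
    have "partition_on UNIV P" using assms by (simp add: moves_with_mean_def)
    then obtain C where "C \<in> P" "i \<in> C" by (rule partition_on_UNIV_E)
    then show ?thesis using assms by (simp add: moves_with_mean_def)
  qed
  then show ?thesis by (simp add: vec_eq_iff)
qed

lemma moves_with_mean_exists:
  assumes P: "partition_on UNIV P"
  obtains v where "moves_with_mean v0 P v"
proof
  let ?v = "\<chi> i. cluster_mean v0 (THE C. C \<in> P \<and> i \<in> C)"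
  have "(THE C. C \<in> P \<and> i \<in> C) = D" if "D \<in> P" "i \<in> D" for i D
    using that partition_onD2[OF P] by (intro the_equality) (auto simp: disjoint_def)
  then show "moves_with_mean v0 P ?v" by (simp add: moves_with_mean_def P)
qed

text \<open>The summand \<open>real (card C) *\<^sub>R u C\<close> is the initial momentum of
  \<open>C\<close>, and these add up to the initial momentum of \<open>D\<close>. For states obeying
  the invariant, the collision rule therefore says: merge, and keep the invariant.\<close>

lemma sticky_collision_iff:
  fixes v :: "real ^ 'n ^ 'N"
  assumes v: "moves_with_mean v0 P v"
  shows "sticky_collision r x P v P' v' \<longleftrightarrow> P' = merged_clusters r x P \<and> moves_with_mean v0 P' v'"
proof -
  have P: "partition_on UNIV P" using v by (simp add: moves_with_mean_def)
  \<comment> \<open>Clusters are nonempty, so the common velocity \<open>u C\<close> is forced to be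
    the mean.\<close>
  have u: "(\<forall>C\<in>P. \<forall>i\<in>C. v $ i = u C) \<longleftrightarrow> (\<forall>C\<in>P. u C = cluster_mean v0 C)" for u
  proof (intro ball_cong refl)
    fix C assume C: "C \<in> P"
    then obtain j where "j \<in> C" using partition_onD3[OF P] by (cases "C = {}") auto
    then show "(\<forall>i\<in>C. v $ i = u C) \<longleftrightarrow> u C = cluster_mean v0 C"
      using v C by (auto simp: moves_with_mean_def)
  qed
  have mean: "(1 / real (\<Sum>C | C \<in> P \<and> C \<subseteq> D. card C)) *\<^sub>R
             (\<Sum>C | C \<in> P \<and> C \<subseteq> D. real (card C) *\<^sub>R u C) = cluster_mean v0 D"
    if D: "D \<in> merged_clusters r x P" and u: "\<forall>C\<in>P. u C = cluster_mean v0 C" for u D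
  proof -
    let ?S = "{C. C \<in> P \<and> C \<subseteq> D}"
    from D obtain A where A: "A \<in> P" "D = merged_cluster r x P A"
      by (auto simp: merged_clusters_eq_image)
    \<comment> \<open>Every agent of \<open>D\<close> comes from a linked cluster, and linked
      clusters lie inside \<open>D\<close>; so the sums in the rule run over a partition of
      \<open>D\<close>.\<close>
    have un: "D = \<Union> ?S"
    proof
      show "D \<subseteq> \<Union> ?S"
      proof
        fix i assume "i \<in> D"
        with A obtain C where C: "(A, C) \<in> (touch_rel r x P)\<^sup>*" "i \<in> C"
          by (auto simp: merged_cluster_def)
        then have "C \<in> P" "C \<subseteq> D" using A touch_rtrancl_mem by (auto simp: merged_cluster_def)
        with C show "i \<in> \<Union> ?S" by blast
      qed
    qed auto
    have disj: "\<forall>C\<in>?S. \<forall>E\<in>?S. C \<noteq> E \<longrightarrow> C \<inter> E = {}"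
      using partition_onD2[OF P] by (auto simp: disjoint_def)
    have "real (card C) *\<^sub>R u C = (\<Sum>i\<in>C. v0 $ i)" if "C \<in> ?S" for C
    proof -
      have "card C \<noteq> 0" using that partition_onD3[OF P] by auto
      then show ?thesis using that u by (simp add: cluster_mean_def)
    qed
    then have "(\<Sum>C\<in>?S. real (card C) *\<^sub>R u C) = (\<Sum>C\<in>?S. \<Sum>i\<in>C. v0 $ i)"
      by (rule sum.cong[OF refl])
    also have "\<dots> = (\<Sum>i\<in>\<Union>?S. v0 $ i)"
      using disj by (subst sum.Union_disjoint) auto
    finally have 1: "(\<Sum>C\<in>?S. real (card C) *\<^sub>R u C) = (\<Sum>i\<in>D. v0 $ i)" using un by simp
    have "card (\<Union>?S) = (\<Sum>C\<in>?S. card C)"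
      using disj by (intro card_Union_disjoint) (auto simp: pairwise_def disjnt_def)
    with un have 2: "(\<Sum>C\<in>?S. card C) = card D" by simp
    show ?thesis unfolding 1 2 cluster_mean_def ..
  qed
  show ?thesis
  proof (cases "P' = merged_clusters r x P")
    case True
    have "sticky_collision r x P v P' v' \<longleftrightarrow> (\<exists>u. (\<forall>C\<in>P. u C = cluster_mean v0 C) \<and>
        (\<forall>D\<in>P'. \<forall>i\<in>D. v' $ i = cluster_mean v0 D))"
      proof
      assume "sticky_collision r x P v P' v'"
      then obtain u where *: "\<forall>C\<in>P. u C = cluster_mean v0 C"
        and "\<forall>D\<in>P'. \<forall>i\<in>D. v' $ i = (1 / real (\<Sum>C | C \<in> P \<and> C \<subseteq> D. card C)) *\<^sub>R
             (\<Sum>C | C \<in> P \<and> C \<subseteq> D. real (card C) *\<^sub>R u C)"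
        unfolding sticky_collision_def u by blast
      then have "\<forall>D\<in>P'. \<forall>i\<in>D. v' $ i = cluster_mean v0 D"
        using mean[OF _ *] True by simp
      with * show "\<exists>u. (\<forall>C\<in>P. u C = cluster_mean v0 C) \<and>
          (\<forall>D\<in>P'. \<forall>i\<in>D. v' $ i = cluster_mean v0 D)" by blast
    next
      assume "\<exists>u. (\<forall>C\<in>P. u C = cluster_mean v0 C) \<and>
          (\<forall>D\<in>P'. \<forall>i\<in>D. v' $ i = cluster_mean v0 D)"
      then have "\<forall>D\<in>P'. \<forall>i\<in>D. v' $ i = cluster_mean v0 D" by blast
      then show "sticky_collision r x P v P' v'"
        unfolding sticky_collision_def u
        using mean[of _ "cluster_mean v0"] True by (intro conjI exI[of _ "cluster_mean v0"]) simp_all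
    qed
    also have "\<dots> \<longleftrightarrow> moves_with_mean v0 P' v'"
      using True partition_on_merged[OF P, of r x] by (auto simp: moves_with_mean_def)
    finally show ?thesis using True by simp
  qed (simp add: sticky_collision_def)
qed

text \<open>Starts the invariant before the clustering at time 0: the mean over one agent is its own
  velocity.\<close>

lemma moves_with_mean_singletons: "moves_with_mean v (range (\<lambda>i. {i})) v"
  by (auto simp: moves_with_mean_def cluster_mean_def partition_on_def disjoint_def)

lemma sticky_collision_separated:
  assumes "moves_with_mean v0 P v" "separated r x P"
  shows "sticky_collision r x P v P v"
  using assms by (simp add: sticky_collision_iff[OF assms(1)] merged_clusters_separated)

section \<open>Existence of the evolution\<close>

text \<open>The part of \<open>sticky_evolution\<close> that is local in time, without the initial
  conditions, so that flows can be shifted and glued.\<close>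

definition sticky_flow ::
  "real \<Rightarrow> (real \<Rightarrow> real ^ 'n ^ 'N) \<Rightarrow> (real \<Rightarrow> real ^ 'n ^ 'N) \<Rightarrow> (real \<Rightarrow> 'N set set) \<Rightarrow> bool" where
  "sticky_flow r X V P \<longleftrightarrow>
     (\<forall>t\<ge>0. \<exists>e>t. \<forall>s\<in>{t..<e}. P s = P t \<and> V s = V t \<and> X s = X t + (s - t) *\<^sub>R V t) \<and>
     (\<forall>t>0. \<exists>s\<in>{0..<t}.
        (\<forall>w\<in>{s..<t}. P w = P s \<and> V w = V s) \<and>
        (\<forall>w\<in>{s..t}. X w = X s + (w - s) *\<^sub>R V s) \<and>
        sticky_collision r (X t) (P s) (V s) (P t) (V t))"

lemma sticky_flow_right:
  assumes flow: "sticky_flow r X V P" and "t \<ge> 0"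
  shows "\<exists>e>t. \<forall>s\<in>{t..<e}. P s = P t \<and> V s = V t \<and> X s = X t + (s - t) *\<^sub>R V t"
  using assms unfolding sticky_flow_def by blast

lemma sticky_flow_left_exists:
  assumes flow: "sticky_flow r X V P" and "t > 0"
  shows "\<exists>s\<in>{0..<t}. (\<forall>w\<in>{s..<t}. P w = P s \<and> V w = V s) \<and>
      (\<forall>w\<in>{s..t}. X w = X s + (w - s) *\<^sub>R V s) \<and>
      sticky_collision r (X t) (P s) (V s) (P t) (V t)"
  using assms unfolding sticky_flow_def by blast

lemma sticky_evolution_iff:
  "sticky_evolution r x v X V P \<longleftrightarrow>
     X 0 = x \<and> sticky_collision r x (range (\<lambda>i. {i})) v (P 0) (V 0) \<and> sticky_flow r X V P"
  by (simp add: sticky_evolution_def sticky_flow_def)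

text \<open>Expresses separation by strict inequalities for finitely many pairs of agents, which
  makes the set of contact times closed.\<close>

lemma separated_iff_torus_dist:
  "separated r x P \<longleftrightarrow>
     (\<forall>(i, j)\<in>{(i, j). \<exists>A\<in>P. \<exists>B\<in>P. A \<noteq> B \<and> i \<in> A \<and> j \<in> B}. r < torus_dist (x $ i) (x $ j))"
  unfolding separated_def clusters_touch_def by (fastforce simp: not_le)

text \<open>The contact times form a closed set bounded below by 0. If nonempty, it has a first
  element, which is positive because the start is separated.\<close>

lemma free_flight_cases:
  fixes x v :: "real ^ 'n ^ 'N"
  assumes "separated r x P"
  obtains (free) "\<And>t. t \<ge> 0 \<Longrightarrow> separated r (x + t *\<^sub>R v) P"
  | (collision) \<tau> where "\<tau> > 0" "\<not> separated r (x + \<tau> *\<^sub>R v) P"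
      "\<And>t. 0 \<le> t \<Longrightarrow> t < \<tau> \<Longrightarrow> separated r (x + t *\<^sub>R v) P"
proof (cases "\<forall>t\<ge>0. separated r (x + t *\<^sub>R v) P")
  case True
  then show ?thesis using free by blast
next
  case False
  define S where "S = {t. t \<ge> 0 \<and> \<not> separated r (x + t *\<^sub>R v) P}"
  let ?I = "{(i, j). \<exists>A\<in>P. \<exists>B\<in>P. A \<noteq> B \<and> i \<in> A \<and> j \<in> B}"
  let ?d = "\<lambda>(i, j) t. torus_dist ((x + t *\<^sub>R v) $ i) ((x + t *\<^sub>R v) $ j)"
  have "S = (\<Union>p\<in>?I. {t. 0 \<le> t \<and> ?d p t \<le> r})"
    unfolding S_def separated_iff_torus_dist by (fastforce simp: not_less)
  moreover have "closed {t. 0 \<le> t \<and> ?d p t \<le> r}" for p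
  proof -
    have "continuous_on UNIV (?d p)"
      unfolding torus_dist_def split_def by (intro continuous_intros)
    then show ?thesis by (intro closed_Collect_conj closed_Collect_le continuous_intros)
  qed
  ultimately have "closed S" by (simp add: closed_UN)
  moreover have "S \<noteq> {}" using False by (auto simp: S_def)
  moreover have bdd: "bdd_below S" by (rule bdd_belowI[of _ 0]) (simp add: S_def)
  ultimately have inS: "Inf S \<in> S" by (intro closed_contains_Inf)
  moreover have "0 \<notin> S" using assms by (simp add: S_def)
  ultimately have "Inf S > 0" unfolding S_def by (metis (mono_tags, lifting) mem_Collect_eq order_le_less)
  moreover have "separated r (x + t *\<^sub>R v) P" if "0 \<le> t" "t < Inf S" for t
    using that cInf_lower[OF _ bdd, of t] by (force simp: S_def)
  ultimately show ?thesis using collision[of "Inf S"] inS by (auto simp: S_def)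
qed

lemma sticky_flow_free:
  assumes "moves_with_mean v0 P v" "\<And>t. t \<ge> 0 \<Longrightarrow> separated r (x + t *\<^sub>R v) P"
  shows "sticky_flow r (\<lambda>t. x + t *\<^sub>R v) (\<lambda>_. v) (\<lambda>_. P)"
  unfolding sticky_flow_def
proof (intro conjI allI impI)
  fix t :: real assume "t \<ge> 0"
  then show "\<exists>e>t. \<forall>s\<in>{t..<e}. P = P \<and> v = v \<and> x + s *\<^sub>R v = x + t *\<^sub>R v + (s - t) *\<^sub>R v"
    by (intro exI[of _ "t + 1"]) (simp add: algebra_simps)
next
  fix t :: real assume "t > 0"
  then show "\<exists>s\<in>{0..<t}. (\<forall>w\<in>{s..<t}. P = P \<and> v = v) \<and>
      (\<forall>w\<in>{s..t}. x + w *\<^sub>R v = x + s *\<^sub>R v + (w - s) *\<^sub>R v) \<and>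
      sticky_collision r (x + t *\<^sub>R v) P v P v"
    using sticky_collision_separated[OF assms(1) assms(2)[of t]] by (intro bexI[of _ 0]) auto
qed

text \<open>Free flight on \<open>{0..<\<tau>}\<close> followed by a given flow delayed by
  \<open>\<tau>\<close>. The one new condition is at \<open>\<tau>\<close>, where
  \<open>coll\<close> links the states on both sides; elsewhere the conditions are
  inherited.\<close>

lemma sticky_flow_glue:
  assumes v: "moves_with_mean v0 P v" and \<tau>: "\<tau> > 0"
    and sep: "\<And>t. 0 \<le> t \<Longrightarrow> t < \<tau> \<Longrightarrow> separated r (x + t *\<^sub>R v) P"
    and X0: "X 0 = x + \<tau> *\<^sub>R v"
    and coll: "sticky_collision r (X 0) P v (Q 0) (V 0)"
    and flow: "sticky_flow r X V Q"
  shows "sticky_flow r (\<lambda>t. if t < \<tau> then x + t *\<^sub>R v else X (t - \<tau>))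
     (\<lambda>t. if t < \<tau> then v else V (t - \<tau>)) (\<lambda>t. if t < \<tau> then P else Q (t - \<tau>))"
    (is "sticky_flow r ?X ?V ?P")
  unfolding sticky_flow_def
proof (intro conjI allI impI)
  fix t :: real assume t: "t \<ge> 0"
  show "\<exists>e>t. \<forall>s\<in>{t..<e}. ?P s = ?P t \<and> ?V s = ?V t \<and> ?X s = ?X t + (s - t) *\<^sub>R ?V t"
  proof (cases "t < \<tau>")
    case True
    then show ?thesis by (intro exI[of _ \<tau>]) (simp add: algebra_simps)
  next
    case False
    then have "t - \<tau> \<ge> 0" by simp
    then obtain e where e: "e > t - \<tau>"
      "\<forall>s\<in>{t-\<tau>..<e}. Q s = Q (t-\<tau>) \<and> V s = V (t-\<tau>) \<and> X s = X (t-\<tau>) + (s - (t-\<tau>)) *\<^sub>R V (t-\<tau>)"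
      using sticky_flow_right[OF flow] by blast
    have "?P s = ?P t \<and> ?V s = ?V t \<and> ?X s = ?X t + (s - t) *\<^sub>R ?V t" if "s \<in> {t..<e+\<tau>}" for s
    proof -
      have "s - \<tau> \<in> {t-\<tau>..<e}" "\<not> s < \<tau>" using that False by auto
      with bspec[OF e(2) this(1)] False show ?thesis by simp
    qed
    moreover have "e + \<tau> > t" using e(1) by simp
    ultimately show ?thesis by blast
  qed
next
  fix t :: real assume t: "t > 0"
  consider "t < \<tau>" | "t = \<tau>" | "t > \<tau>" by linarith
  then show "\<exists>s\<in>{0..<t}. (\<forall>w\<in>{s..<t}. ?P w = ?P s \<and> ?V w = ?V s) \<and>
      (\<forall>w\<in>{s..t}. ?X w = ?X s + (w - s) *\<^sub>R ?V s) \<and>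
      sticky_collision r (?X t) (?P s) (?V s) (?P t) (?V t)"
  proof cases
    case 1
    then show ?thesis
      using t sticky_collision_separated[OF v sep[of t]] by (intro bexI[of _ 0]) auto
  next
    case 2
    then show ?thesis using t coll X0 by (intro bexI[of _ 0]) auto
  next
    case 3
    then have "t - \<tau> > 0" by simp
    then obtain s where s: "s \<in> {0..<t-\<tau>}" "\<forall>w\<in>{s..<t-\<tau>}. Q w = Q s \<and> V w = V s"
      "\<forall>w\<in>{s..t-\<tau>}. X w = X s + (w - s) *\<^sub>R V s"
      "sticky_collision r (X (t-\<tau>)) (Q s) (V s) (Q (t-\<tau>)) (V (t-\<tau>))"
      using sticky_flow_left_exists[OF flow] by blast
    have s\<tau>: "\<not> s + \<tau> < \<tau>" "\<not> t < \<tau>" "s + \<tau> \<in> {0..<t}" using s(1) 3 \<tau> by auto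
    have "?P w = ?P (s+\<tau>) \<and> ?V w = ?V (s+\<tau>)" if "w \<in> {s+\<tau>..<t}" for w
    proof -
      have "w - \<tau> \<in> {s..<t-\<tau>}" "\<not> w < \<tau>" using that s\<tau> by auto
      with bspec[OF s(2) this(1)] s\<tau> show ?thesis by simp
    qed
    moreover have "?X w = ?X (s+\<tau>) + (w - (s+\<tau>)) *\<^sub>R ?V (s+\<tau>)" if "w \<in> {s+\<tau>..t}" for w
    proof -
      have "w - \<tau> \<in> {s..t-\<tau>}" "\<not> w < \<tau>" using that s\<tau> by auto
      with bspec[OF s(3) this(1)] s\<tau> show ?thesis by (simp add: diff_diff_add add.commute)
    qed
    moreover have "sticky_collision r (?X t) (?P (s+\<tau>)) (?V (s+\<tau>)) (?P t) (?V t)"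
      using s(4) s\<tau> by simp
    ultimately show ?thesis using s\<tau>(3) by blast
  qed
qed

text \<open>Induction on the number of clusters: fly freely up to the first contact, merge, and
  continue with the flow from the induction hypothesis. A contact strictly lowers the count.\<close>

lemma sticky_flow_exists:
  fixes x v0 v :: "real ^ 'n ^ 'N"
  assumes "moves_with_mean v0 P v" "separated r x P"
  shows "\<exists>X V Q. X 0 = x \<and> V 0 = v \<and> Q 0 = P \<and> sticky_flow r X V Q"
  using assms
proof (induction "card P" arbitrary: x v P rule: less_induct)
  case less
  note v = less.prems(1)
  show ?case
  proof (cases rule: free_flight_cases[OF less.prems(2), of v])
    case 1
    then show ?thesis
      using sticky_flow_free[OF v]
      by (intro exI[of _ "\<lambda>t. x + t *\<^sub>R v"] exI[of _ "\<lambda>_. v"] exI[of _ "\<lambda>_. P"]) auto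
  next
    case (2 \<tau>)
    let ?y = "x + \<tau> *\<^sub>R v" let ?Q = "merged_clusters r ?y P"
    have P: "partition_on UNIV P" using v by (simp add: moves_with_mean_def)
    have "card ?Q < card P"
      using card_merged_le[of r ?y P] separated_if_card_merged_eq[of r ?y P] 2(2) by linarith
    moreover obtain w where w: "moves_with_mean v0 ?Q w"
      using moves_with_mean_exists[OF partition_on_merged[OF P]] by blast
    ultimately obtain X V Q where
      XVQ: "X 0 = ?y" "V 0 = w" "Q 0 = ?Q" "sticky_flow r X V Q"
      using less.hyps[OF _ w separated_merged[OF P]] by blast
    have "sticky_collision r (X 0) P v (Q 0) (V 0)"
      using XVQ w by (simp add: sticky_collision_iff[OF v])
    from sticky_flow_glue[OF v 2(1) 2(3) XVQ(1) this XVQ(4)]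
    show ?thesis using 2(1)
      by (intro exI[of _ "\<lambda>t. if t < \<tau> then x + t *\<^sub>R v else X (t - \<tau>)"]
          exI[of _ "\<lambda>t. if t < \<tau> then v else V (t - \<tau>)"]
          exI[of _ "\<lambda>t. if t < \<tau> then P else Q (t - \<tau>)"]) simp
  qed
qed

lemma sticky_evolution_exists:
  fixes x v :: "real ^ 'n ^ 'N"
  shows "\<exists>X V P. sticky_evolution r x v X V P"
proof -
  let ?P = "range (\<lambda>i. {i}) :: 'N set set"
  note v = moves_with_mean_singletons[of v]
  then have P: "partition_on UNIV ?P" by (simp add: moves_with_mean_def)
  obtain w where w: "moves_with_mean v (merged_clusters r x ?P) w"
    using moves_with_mean_exists[OF partition_on_merged[OF P]] by blast
  from sticky_flow_exists[OF w separated_merged[OF P]] w show ?thesis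
    unfolding sticky_evolution_iff sticky_collision_iff[OF v] by metis
qed

section \<open>Long-time behaviour of an evolution\<close>

text \<open>Continuous induction: at the infimum of the failures \<open>left\<close> gives
  \<open>Q\<close>, and \<open>right\<close> carries it beyond, a contradiction. Its two steps match
  the one-sided local description of a flow.\<close>

lemma real_interval_induct:
  fixes Q :: "real \<Rightarrow> bool"
  assumes base: "Q a"
    and right: "\<And>t. t \<ge> a \<Longrightarrow> Q t \<Longrightarrow> \<exists>e>t. \<forall>s\<in>{t..<e}. Q s"
    and left: "\<And>t. t > a \<Longrightarrow> (\<And>s. a \<le> s \<Longrightarrow> s < t \<Longrightarrow> Q s) \<Longrightarrow> Q t"
    and "t \<ge> a"
  shows "Q t"
proof (rule ccontr)
  assume "\<not> Q t"
  define S where "S = {s. s \<ge> a \<and> \<not> Q s}"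
  have ne: "S \<noteq> {}" using \<open>\<not> Q t\<close> \<open>t \<ge> a\<close> by (auto simp: S_def)
  have bdd: "bdd_below S" by (rule bdd_belowI[of _ a]) (simp add: S_def)
  have ge: "Inf S \<ge> a" using ne by (intro cInf_greatest) (auto simp: S_def)
  have less: "Q s" if "a \<le> s" "s < Inf S" for s
    using that cInf_lower[OF _ bdd, of s] by (force simp: S_def)
  have "Q (Inf S)"
  proof (cases "Inf S = a")
    case False
    with ge have "Inf S > a" by simp
    then show ?thesis using less by (rule left)
  qed (simp add: base)
  then obtain e where e: "e > Inf S" "\<forall>s\<in>{Inf S..<e}. Q s" using right[OF ge] by blast
  then obtain s where "s \<in> S" "s < e" using cInf_lessD[OF ne e(1)] by blast
  with cInf_lower[OF \<open>s \<in> S\<close> bdd] have "s \<in> {Inf S..<e}" by simp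
  from bspec[OF e(2) this] \<open>s \<in> S\<close> show False unfolding S_def by blast
qed

lemma sticky_flow_left:
  assumes flow: "sticky_flow r X V P" and "t > a" "a \<ge> 0"
  obtains s where "a \<le> s" "s < t" "X t = X s + (t - s) *\<^sub>R V s"
    "sticky_collision r (X t) (P s) (V s) (P t) (V t)"
proof -
  obtain s where s: "s \<in> {0..<t}" "\<forall>w\<in>{s..<t}. P w = P s \<and> V w = V s"
      "\<forall>w\<in>{s..t}. X w = X s + (w - s) *\<^sub>R V s" "sticky_collision r (X t) (P s) (V s) (P t) (V t)"
    using sticky_flow_left_exists[OF flow order_le_less_trans[OF \<open>a \<ge> 0\<close> \<open>t > a\<close>]] by blast
  \<comment> \<open>State and velocity are constant on \<open>{s..<t}\<close>, so the left interval
    may be shortened to begin no earlier than \<open>a\<close>.\<close>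
  let ?s = "max a s"
  have mem: "?s \<in> {s..<t}" "?s \<in> {s..t}" "t \<in> {s..t}" using s(1) \<open>t > a\<close> by auto
  have PV: "P ?s = P s" "V ?s = V s" using bspec[OF s(2) mem(1)] by auto
  have "X ?s + (t - ?s) *\<^sub>R V s = X s + ((?s - s) + (t - ?s)) *\<^sub>R V s"
    unfolding bspec[OF s(3) mem(2)] scaleR_add_left by (simp only: add.assoc)
  also have "\<dots> = X t" unfolding bspec[OF s(3) mem(3)] by simp
  finally have "X t = X ?s + (t - ?s) *\<^sub>R V ?s" using PV by simp
  moreover have "a \<le> ?s" "?s < t" using mem by auto
  ultimately show ?thesis using that[of ?s] s(4) PV by simp
qed

lemma sticky_evolution_moves_with_mean:
  assumes "sticky_evolution r x v X V P" "t \<ge> 0"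
  shows "moves_with_mean v (P t) (V t)"
proof -
  have flow: "sticky_flow r X V P" using assms by (simp add: sticky_evolution_iff)
  show ?thesis
  proof (rule real_interval_induct[where a = 0 and Q = "\<lambda>t. moves_with_mean v (P t) (V t)"])
    show "moves_with_mean v (P 0) (V 0)"
      using assms(1) unfolding sticky_evolution_iff sticky_collision_iff[OF moves_with_mean_singletons]
      by blast
    show "\<exists>e>t. \<forall>s\<in>{t..<e}. moves_with_mean v (P s) (V s)"
      if "t \<ge> 0" "moves_with_mean v (P t) (V t)" for t
      using sticky_flow_right[OF flow that(1)] that(2) by metis
    show "moves_with_mean v (P t) (V t)"
      if t: "t > 0" and IH: "\<And>s. 0 \<le> s \<Longrightarrow> s < t \<Longrightarrow> moves_with_mean v (P s) (V s)" for t
    proof -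
      obtain s where s: "0 \<le> s" "s < t" "sticky_collision r (X t) (P s) (V s) (P t) (V t)"
        using sticky_flow_left[OF flow t] by blast
      then show ?thesis using sticky_collision_iff[OF IH[OF s(1,2)]] by blast
    qed
  qed (rule assms)
qed

lemma card_clusters_antimono:
  assumes flow: "sticky_flow r X V P" and "0 \<le> s" "s \<le> t"
  shows "card (P t) \<le> card (P s)"
proof (rule real_interval_induct[where a = s and Q = "\<lambda>t. card (P t) \<le> card (P s)"])
  show "\<exists>e>t. \<forall>w\<in>{t..<e}. card (P w) \<le> card (P s)" if "s \<le> t" "card (P t) \<le> card (P s)" for t
  proof -
    have "t \<ge> 0" using that \<open>0 \<le> s\<close> by simp
    from sticky_flow_right[OF flow this] that(2) show ?thesis by metis
  qed
  show "card (P t) \<le> card (P s)"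
    if t: "s < t" and IH: "\<And>w. s \<le> w \<Longrightarrow> w < t \<Longrightarrow> card (P w) \<le> card (P s)" for t
  proof -
    obtain w where w: "s \<le> w" "w < t" "sticky_collision r (X t) (P w) (V w) (P t) (V t)"
      using sticky_flow_left[OF flow t \<open>0 \<le> s\<close>] by blast
    from w(3) have "card (P t) \<le> card (P w)" by (simp add: sticky_collision_def card_merged_le)
    also have "\<dots> \<le> card (P s)" by (rule IH[OF w(1,2)])
    finally show ?thesis .
  qed
qed (use assms in auto)

text \<open>Choose \<open>T\<close> minimising the number of clusters. The count is constant
  afterwards, so every later merging is trivial, and the clusters, hence the velocities, stay
  fixed.\<close>

lemma sticky_evolution_eventually_free:
  assumes evol: "sticky_evolution r x v X V P"
  obtains T where "T \<ge> 0"
    "\<And>t. t \<ge> T \<Longrightarrow> P t = P T \<and> V t = V T \<and> X t = X T + (t - T) *\<^sub>R V T"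
    "\<And>t. t > T \<Longrightarrow> separated r (X t) (P T)"
proof -
  have flow: "sticky_flow r X V P" using evol by (simp add: sticky_evolution_iff)
  obtain T where T: "T \<ge> 0" "\<And>t. t \<ge> 0 \<Longrightarrow> card (P T) \<le> card (P t)"
    using ex_has_least_nat[of "\<lambda>t. t \<ge> 0" 0 "\<lambda>t. card (P t)"] by auto
  have same_card: "card (P t) = card (P T)" if "t \<ge> T" for t
    using card_clusters_antimono[OF flow T(1) that] T that by (simp add: order_antisym)
  let ?Q = "\<lambda>t. P t = P T \<and> V t = V T \<and> X t = X T + (t - T) *\<^sub>R V T"
  \<comment> \<open>Serves twice: as the left step of the continuous induction for
    \<open>?Q\<close>, and afterwards to read off separation at every time after
    \<open>T\<close>.\<close>
  have step: "separated r (X t) (P T) \<and> ?Q t" if t: "t > T" and IH: "\<And>s. T \<le> s \<Longrightarrow> s < t \<Longrightarrow> ?Q s" for t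
  proof -
    obtain s where s: "T \<le> s" "s < t" "X t = X s + (t - s) *\<^sub>R V s"
      "sticky_collision r (X t) (P s) (V s) (P t) (V t)"
      using sticky_flow_left[OF flow t T(1)] by blast
    have Qs: "?Q s" by (rule IH[OF s(1,2)])
    have mean: "moves_with_mean v (P u) (V u)" if "u \<ge> 0" for u
      using sticky_evolution_moves_with_mean[OF evol that] .
    have "P t = merged_clusters r (X t) (P T)" using s(4) Qs by (simp add: sticky_collision_def)
    then have sep: "separated r (X t) (P T)"
      using same_card[of t] t by (intro separated_if_card_merged_eq) simp
    with \<open>P t = _\<close> have PT: "P t = P T" by (simp add: merged_clusters_separated)
    then have "V t = V T"
      using moves_with_mean_unique[of v "P T"] mean[of t] mean[of T] T(1) t by simp
    moreover have "X t = X T + (t - T) *\<^sub>R V T" using s(3) Qs by (simp add: algebra_simps)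
    ultimately show ?thesis using sep PT by simp
  qed
  have Q: "?Q t" if "t \<ge> T" for t
  proof (rule real_interval_induct[where a = T and Q = ?Q])
    show "\<exists>e>t. \<forall>s\<in>{t..<e}. ?Q s" if t: "t \<ge> T" and Qt: "?Q t" for t
    proof -
      obtain e where e: "e > t"
        "\<forall>s\<in>{t..<e}. P s = P t \<and> V s = V t \<and> X s = X t + (s - t) *\<^sub>R V t"
        using sticky_flow_right[OF flow order_trans[OF T(1) t]] by blast
      have "?Q s" if "s \<in> {t..<e}" for s using bspec[OF e(2) that] Qt by (simp add: algebra_simps)
      with e(1) show ?thesis by blast
    qed
    show "?Q t" if "t > T" "\<And>s. T \<le> s \<Longrightarrow> s < t \<Longrightarrow> ?Q s" for t
      using step[OF that] by blast
  qed (use that in auto)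
  show ?thesis
  proof (rule that[OF T(1) Q])
    show "separated r (X t) (P T)" if "t > T" for t using step[OF that Q] by blast
  qed
qed

section \<open>Dense lines on the torus\<close>

text \<open>The coefficients are indexed by coordinates and not by values, so two equal components
  already count as a relation.\<close>

definition int_independent :: "real ^ 'n \<Rightarrow> bool" where
  "int_independent w \<longleftrightarrow> (\<forall>m :: 'n \<Rightarrow> int. (\<Sum>k\<in>UNIV. of_int (m k) * w $ k) = 0 \<longrightarrow> m = (\<lambda>_. 0))"

lemma int_independentD:
  fixes m :: "'n::finite \<Rightarrow> int"
  assumes "int_independent w" "(\<Sum>k\<in>UNIV. of_int (m k) * w $ k) = 0"
  shows "m k = 0"
  using assms unfolding int_independent_def by meson

text \<open>Kronecker's theorem for a line with real time, transferred from indices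
  \<open>{..<n}\<close> to a finite type and strengthened to arbitrarily late times.\<close>

lemma int_independent_line_approx:
  fixes w :: "real ^ 'n"
  assumes w: "int_independent w" and "e > 0"
  obtains t h where "t \<ge> T" "\<And>k. \<bar>t * w $ k - of_int (h k) - a k\<bar> < e"
proof -
  \<comment> \<open>The reals as a module over the integers: \<open>independent\<close> below refers
    to this scalar action.\<close>
  interpret Modules.module "(\<lambda>r. (*) (real_of_int r))"
    by (simp add: Modules.module.intro distrib_left mult.commute)
  let ?n = "CARD('n)"
  obtain f where f: "bij_betw f {..<?n} (UNIV :: 'n set)"
    using ex_bij_betw_nat_finite[of "UNIV :: 'n set"] by (auto simp: atLeast0LessThan)
  define g where "g = the_inv_into {..<?n} f"
  have g: "g k < ?n" "f (g k) = k" for k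
  proof -
    have "g k \<in> {..<?n}"
      unfolding g_def using bij_betw_imp_surj_on[OF f] bij_betw_imp_inj_on[OF f]
      by (intro the_inv_into_into) auto
    then show "g k < ?n" by simp
    show "f (g k) = k" unfolding g_def using f_the_inv_into_f_bij_betw[OF f] by simp
  qed
  define \<theta> where "\<theta> = (\<lambda>i. w $ f i)"
  have inj_w: "inj (\<lambda>k. w $ k)"
  proof (rule injI, rule ccontr)
    fix k l assume kl: "w $ k = w $ l" "k \<noteq> l"
    \<comment> \<open>The difference of the unit vectors at \<open>k\<close> and \<open>l\<close>, a
      nontrivial relation if these components agree.\<close>
    let ?m = "\<lambda>j. (if j = k then 1 else 0) - (if j = l then 1 else 0) :: int"
    have "(\<Sum>j\<in>UNIV. of_int (?m j) * w $ j) =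
        (\<Sum>j\<in>UNIV. (if j = k then w $ j else 0)) - (\<Sum>j\<in>UNIV. (if j = l then w $ j else 0))"
      unfolding sum_subtractf[symmetric] by (rule sum.cong) auto
    also have "\<dots> = 0" using kl by simp
    finally have "?m k = 0" by (rule int_independentD[OF w])
    with kl show False by simp
  qed
  have inj: "inj_on \<theta> {..<?n}"
    using comp_inj_on[OF bij_betw_imp_inj_on[OF f] inj_on_subset[OF inj_w subset_UNIV]]
    by (simp add: \<theta>_def comp_def)
  have indep: "independent (\<theta> ` {..<?n})"
  proof -
    have range: "\<theta> ` {..<?n} = range (\<lambda>k. w $ k)"
    proof -
      have "\<theta> ` {..<?n} = (\<lambda>k. w $ k) ` (f ` {..<?n})" by (simp only: \<theta>_def image_image)
      then show ?thesis unfolding bij_betw_imp_surj_on[OF f] .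
    qed
    have "u y = 0" if "(\<Sum>y\<in>\<theta> ` {..<?n}. real_of_int (u y) * y) = 0" "y \<in> \<theta> ` {..<?n}" for u y
    proof -
      have "(\<Sum>k\<in>UNIV. of_int (u (w $ k)) * w $ k) = 0"
        using that(1) unfolding range sum.reindex[OF inj_w] by simp
      then have "u (w $ k) = 0" for k by (rule int_independentD[OF w])
      then show ?thesis using that(2) unfolding range by auto
    qed
    then show ?thesis unfolding dependent_finite[OF finite_imageI[OF finite_lessThan]] by blast
  qed
  obtain t0 h where t0: "\<And>i. i < ?n \<Longrightarrow> \<bar>t0 * \<theta> i - of_int (h i) - a (f i)\<bar> < e / 2"
    using Kronecker_thm_1[OF indep inj, of "e / 2" "\<lambda>i. a (f i)"] \<open>e > 0\<close> half_gt_zero by blast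
  \<comment> \<open>\<open>t0\<close> has no sign: add a large almost-period of the line, provided by Dirichlet's theorem.\<close>
  obtain N :: nat where N: "N \<noteq> 0" "1 / N < e / 2"
    using real_arch_inverse[THEN iffD1, OF half_gt_zero[OF \<open>e > 0\<close>]]
    unfolding inverse_eq_divide by blast
  \<comment> \<open>As \<open>q\<close> is at least 1 and \<open>L\<close> is positive, the shift
    \<open>q * L\<close> is at least \<open>T - t0\<close>. Each of the two approximations has error
    below \<open>e / 2\<close>.\<close>
  define L where "L = max 1 (T - t0)"
  obtain q p where q: "0 < q" "\<And>i. i < ?n \<Longrightarrow> \<bar>of_int q * (L * \<theta> i) - of_int (p i)\<bar> < 1 / N"
    using Dirichlet_approx_simult[of N ?n "\<lambda>i. L * \<theta> i"] N(1) by blast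
  show ?thesis
  proof (rule that[of "t0 + of_int q * L" "\<lambda>k. h (g k) + p (g k)"])
    have "1 * L \<le> of_int q * L" using q(1) by (intro mult_right_mono) (auto simp: L_def)
    then show "T \<le> t0 + of_int q * L" by (simp add: L_def)
    show "\<bar>(t0 + of_int q * L) * w $ k - of_int (h (g k) + p (g k)) - a k\<bar> < e" for k
    proof -
      have "\<bar>(t0 * w $ k - of_int (h (g k)) - a k) + (of_int q * (L * w $ k) - of_int (p (g k)))\<bar> < e"
        using t0[OF g(1)[of k]] q(2)[OF g(1)[of k]] N(2) unfolding \<theta>_def g(2) by linarith
      also have "(t0 * w $ k - of_int (h (g k)) - a k) + (of_int q * (L * w $ k) - of_int (p (g k)))
          = (t0 + of_int q * L) * w $ k - of_int (h (g k) + p (g k)) - a k"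
        by (simp add: algebra_simps)
      finally show ?thesis .
    qed
  qed
qed

lemma torus_line_dense:
  fixes a w :: "real ^ 'n"
  assumes w: "int_independent w" and "e > 0"
  obtains t where "t \<ge> T" "infdist (a + t *\<^sub>R w) torus_periods \<le> e"
proof -
  let ?n = "CARD('n)"
  \<comment> \<open>The factor \<open>2 * pi\<close> rescales the integer lattice to the periods;
    \<open>?n\<close> accounts for bounding the norm by the sum over the coordinates.\<close>
  let ?d = "e / (2 * pi * ?n)"
  have d: "?d > 0" using \<open>e > 0\<close> by simp
  obtain t h where th: "t \<ge> T / (2 * pi)"
    "\<And>k. \<bar>t * w $ k - of_int (h k) - (- a $ k / (2 * pi))\<bar> < ?d"
    using int_independent_line_approx[OF w d, of "T / (2 * pi)" "\<lambda>k. - a $ k / (2 * pi)"] by blast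
  let ?z = "\<chi> k. 2 * pi * of_int (h k) :: real ^ 'n"
  let ?t = "2 * pi * t"
  have "?z \<in> torus_periods" by (auto simp: torus_periods_def)
  then have "infdist (a + ?t *\<^sub>R w) torus_periods \<le> norm (a + ?t *\<^sub>R w - ?z)"
    using infdist_le by (metis dist_norm)
  also have "\<dots> \<le> (\<Sum>k\<in>UNIV. \<bar>(a + ?t *\<^sub>R w - ?z) $ k\<bar>)" by (rule norm_le_l1_cart)
  also have "\<dots> \<le> (\<Sum>k\<in>(UNIV :: 'n set). e / ?n)"
  proof (rule sum_mono)
    fix k
    have "2 * pi * (- a $ k / (2 * pi)) = - a $ k" by simp
    then have "(a + ?t *\<^sub>R w - ?z) $ k = 2 * pi * (t * w $ k - of_int (h k) - (- a $ k / (2 * pi)))"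
      unfolding right_diff_distrib by simp
    then have "\<bar>(a + ?t *\<^sub>R w - ?z) $ k\<bar> = 2 * pi * \<bar>t * w $ k - of_int (h k) - (- a $ k / (2 * pi))\<bar>"
      by (simp add: abs_mult)
    also have "\<dots> \<le> 2 * pi * ?d" using th(2)[of k] by (intro mult_left_mono) auto
    also have "\<dots> = e / ?n" by simp
    finally show "\<bar>(a + ?t *\<^sub>R w - ?z) $ k\<bar> \<le> e / ?n" .
  qed
  also have "\<dots> = e" by simp
  finally have "infdist (a + ?t *\<^sub>R w) torus_periods \<le> e" .
  moreover have "?t \<ge> T" using th(1) pos_divide_le_eq[of "2 * pi" T t] by (simp add: mult.commute)
  ultimately show ?thesis by (intro that)
qed

section \<open>Generic velocities\<close>

text \<open>Quantifies over all disjoint pairs of possible clusters, since the final partition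
  depends on the positions as well.\<close>

definition generic_velocities :: "real ^ 'n ^ 'N \<Rightarrow> bool" where
  "generic_velocities v \<longleftrightarrow>
     (\<forall>A B. A \<noteq> {} \<longrightarrow> B \<noteq> {} \<longrightarrow> A \<inter> B = {} \<longrightarrow> int_independent (cluster_mean v A - cluster_mean v B))"

text \<open>For fixed \<open>A\<close>, \<open>B\<close> and nonzero \<open>m\<close>, an integer
  relation is one nontrivial linear equation in \<open>v\<close>, so it holds only on a null
  hyperplane.\<close>

lemma AE_generic_velocities:
  "AE (x :: real ^ 'n ^ 'N, v :: real ^ 'n ^ 'N) in lebesgue. generic_velocities v"
proof -
  define c :: "'N set \<Rightarrow> 'N set \<Rightarrow> 'N \<Rightarrow> real" where
    "c A B i = (if i \<in> A then 1 / card A else 0) - (if i \<in> B then 1 / card B else 0)" for A B i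
  \<comment> \<open>The normal vector of that hyperplane: \<open>c A B i\<close> is the weight of
    agent \<open>i\<close> in the difference of the two means, and the position component is
    0.\<close>
  define q where
    "q A B m = (0 :: real ^ 'n ^ 'N, (\<chi> i k. c A B i * of_int (m k)) :: real ^ 'n ^ 'N)"
    for A B and m :: "'n \<Rightarrow> int"
  have inner: "q A B m \<bullet> (x, v) = (\<Sum>k\<in>UNIV. of_int (m k) * (cluster_mean v A - cluster_mean v B) $ k)"
    for A B m x v
  proof -
    have mean: "cluster_mean v A - cluster_mean v B = (\<Sum>i\<in>UNIV. c A B i *\<^sub>R v $ i)"
    proof -
      have "(\<Sum>i\<in>UNIV. (if i \<in> D then 1 / card D else 0) *\<^sub>R v $ i) = cluster_mean v D" for D
        unfolding cluster_mean_def scaleR_sum_right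
        by (rule sum.mono_neutral_cong_right) auto
      then show ?thesis by (simp add: c_def scaleR_diff_left sum_subtractf)
    qed
    have "q A B m \<bullet> (x, v) = (\<Sum>i\<in>UNIV. \<Sum>k\<in>UNIV. of_int (m k) * (c A B i * v $ i $ k))"
      by (simp add: q_def inner_Pair inner_vec_def mult_ac)
    also have "\<dots> = (\<Sum>k\<in>UNIV. of_int (m k) * (\<Sum>i\<in>UNIV. c A B i * v $ i $ k))"
      unfolding sum_distrib_left by (rule sum.swap)
    finally show ?thesis by (simp add: mean)
  qed
  have "AE p in lebesgue. q A B m \<bullet> p \<noteq> 0"
    if A: "A \<noteq> {}" and AB: "A \<inter> B = {}" and m: "m \<noteq> (\<lambda>_. 0)" for A B m
  proof -
    obtain i where i: "i \<in> A" using A by blast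
    obtain k where k: "m k \<noteq> 0" using m by blast
    \<comment> \<open>Disjointness rules out cancellation: only the weight from \<open>A\<close> is
      present at \<open>i\<close>.\<close>
    have "c A B i \<noteq> 0" using i AB by (auto simp: c_def)
    then have "snd (q A B m) $ i $ k \<noteq> 0" using k by (simp add: q_def)
    then have "q A B m \<noteq> 0" by auto
    then have "{p. q A B m \<bullet> p = 0} \<in> null_sets lebesgue"
      using negligible_hyperplane negligible_iff_null_sets by blast
    from AE_not_in[OF this] show ?thesis by simp
  qed
  \<comment> \<open>There are finitely many \<open>A\<close> and \<open>B\<close> and countably many
    \<open>m\<close>, so the exceptional hyperplanes have null union.\<close>
  then have "AE p in lebesgue. \<forall>A B m. A \<noteq> {} \<longrightarrow> A \<inter> B = {} \<longrightarrow> m \<noteq> (\<lambda>_. 0) \<longrightarrow> q A B m \<bullet> p \<noteq> 0"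
    by (simp add: AE_all_countable)
  then show ?thesis
  proof (rule AE_mp[OF _ AE_I2], safe)
    fix x v :: "real ^ 'n ^ 'N"
    assume "\<forall>A B m. A \<noteq> {} \<longrightarrow> A \<inter> B = {} \<longrightarrow> m \<noteq> (\<lambda>_. 0) \<longrightarrow> q A B m \<bullet> (x, v) \<noteq> 0"
    then show "generic_velocities v"
      unfolding generic_velocities_def int_independent_def inner by blast
  qed
qed

lemma sets_initial_data: "initial_data \<in> sets lebesgue"
proof -
  have [measurable]: "(\<lambda>x :: real ^ 'n ^ 'N. x $ i $ k) \<in> borel_measurable borel" for i k
    by (intro borel_measurable_continuous_onI continuous_intros)
  have "{x :: real ^ 'n ^ 'N. \<forall>i k. x $ i $ k \<in> {0..<2 * pi}} \<in> sets borel"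
    by measurable
  then have "initial_data \<in> sets (borel \<Otimes>\<^sub>M (borel :: (real ^ 'n ^ 'N) measure))"
    unfolding initial_data_def by (intro pair_measureI) auto
  then show ?thesis
    unfolding borel_prod by (intro sets_completionI_sets) simp
qed

section \<open>Collapse to one cluster and alignment\<close>

lemma generic_velocities_single_cluster:
  assumes "r > 0" and evol: "sticky_evolution r x v X V P" and generic: "generic_velocities v"
  obtains T where "T \<ge> 0" "\<And>t. t \<ge> T \<Longrightarrow> P t = {UNIV}"
proof -
  obtain T where T: "T \<ge> 0"
    "\<And>t. t \<ge> T \<Longrightarrow> P t = P T \<and> V t = V T \<and> X t = X T + (t - T) *\<^sub>R V T"
    "\<And>t. t > T \<Longrightarrow> separated r (X t) (P T)"
    using sticky_evolution_eventually_free[OF evol] by metis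
  have mean: "moves_with_mean v (P T) (V T)" by (rule sticky_evolution_moves_with_mean[OF evol T(1)])
  then have part: "partition_on UNIV (P T)" by (simp add: moves_with_mean_def)
  have eq: "A = B" if AB: "A \<in> P T" "B \<in> P T" for A B
  proof (rule ccontr)
    assume "A \<noteq> B"
    then have "A \<inter> B = {}" using AB partition_onD2[OF part] by (auto simp: disjoint_def)
    moreover have ne: "A \<noteq> {}" "B \<noteq> {}" using AB partition_onD3[OF part] by auto
    ultimately have indep: "int_independent (cluster_mean v A - cluster_mean v B)"
      using generic by (simp add: generic_velocities_def)
    \<comment> \<open>One agent from each cluster suffices: their relative velocity is the
      difference of the two means, and one pair within \<open>r\<close> is a contact.\<close>
    obtain i j where ij: "i \<in> A" "j \<in> B" using ne by auto
    \<comment> \<open>The bound 1 puts \<open>T + t\<close> strictly after \<open>T\<close>, where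
      separation is known.\<close>
    obtain t where t: "t \<ge> 1" "infdist (X T $ i - X T $ j + t *\<^sub>R (V T $ i - V T $ j)) torus_periods \<le> r"
    proof -
      have "V T $ i = cluster_mean v A" "V T $ j = cluster_mean v B"
        using mean AB ij by (auto simp: moves_with_mean_def)
      then show ?thesis
        using that torus_line_dense[OF indep \<open>r > 0\<close>, of 1 "X T $ i - X T $ j"] by auto
    qed
    have "torus_dist (X (T + t) $ i) (X (T + t) $ j) \<le> r"
    proof -
      have "X (T + t) = X T + t *\<^sub>R V T" using T(2)[of "T + t"] t(1) by simp
      then have "X (T + t) $ i - X (T + t) $ j = X T $ i - X T $ j + t *\<^sub>R (V T $ i - V T $ j)"
        by (simp add: scaleR_right_diff_distrib)
      then show ?thesis using t(2) by (simp only: torus_dist_def)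
    qed
    then have "clusters_touch r (X (T + t)) A B" using ij by (auto simp: clusters_touch_def)
    with T(3)[of "T + t"] t(1) AB \<open>A \<noteq> B\<close> show False by (simp add: separated_def)
  qed
  have "P T = {UNIV}"
  proof -
    obtain A where A: "A \<in> P T" using partition_onD1[OF part] by blast
    with eq have "P T = {A}" by blast
    with partition_onD1[OF part] show ?thesis by simp
  qed
  with T that show ?thesis by metis
qed

theorem proposition2p1:
  fixes r0 :: real
  assumes "r0 > 0"
  shows "AE (x, v) in lebesgue_on (initial_data :: ((real ^ 'n ^ 'N) \<times> (real ^ 'n ^ 'N)) set).
           (\<exists>X V P. sticky_evolution r0 x v X V P) \<and>
           (\<forall>X V P. sticky_evolution r0 x v X V P \<longrightarrow>
              (\<exists>T\<ge>0. \<forall>t\<ge>T. P t = {UNIV}) \<and>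
              ((\<lambda>t. Max (range (\<lambda>(i, j). norm (V t $ i - V t $ j)))) \<longlongrightarrow> 0) at_top)"
proof -
  have concl: "(\<exists>T\<ge>0. \<forall>t\<ge>T. P t = {UNIV}) \<and>
       ((\<lambda>t. Max (range (\<lambda>(i, j). norm (V t $ i - V t $ j)))) \<longlongrightarrow> 0) at_top"
    if generic: "generic_velocities v" and evol: "sticky_evolution r0 x v X V P"
    for x v :: "real ^ 'n ^ 'N" and X V P
  proof -
    obtain T where T: "T \<ge> 0" "\<And>t. t \<ge> T \<Longrightarrow> P t = {UNIV}"
      using generic_velocities_single_cluster[OF assms evol generic] by blast
    \<comment> \<open>With a single cluster all agents have the same mean velocity, so the maximum
      is exactly 0 from \<open>T\<close> on.\<close>
    have "Max (range (\<lambda>(i, j). norm (V t $ i - V t $ j))) = 0" if "t \<ge> T" for t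
    proof -
      have "moves_with_mean v {UNIV} (V t)"
        using sticky_evolution_moves_with_mean[OF evol, of t] T that by simp
      then have "range (\<lambda>(i, j). norm (V t $ i - V t $ j)) = {0}"
        by (auto simp: moves_with_mean_def image_iff)
      then show ?thesis by simp
    qed
    then have "((\<lambda>t. Max (range (\<lambda>(i, j). norm (V t $ i - V t $ j)))) \<longlongrightarrow> 0) at_top"
      by (intro tendsto_eventually) (auto simp: eventually_at_top_linorder)
    with T show ?thesis by blast
  qed
  \<comment> \<open>The generic set has full measure in the whole space, hence in the measurable
    cell of initial data.\<close>
  have "AE (x, v) in lebesgue_on (initial_data :: ((real ^ 'n ^ 'N) \<times> (real ^ 'n ^ 'N)) set).
      generic_velocities v"
    using AE_generic_velocities sets_initial_data
    by (subst AE_restrict_space_iff) auto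
  then show ?thesis
  proof (rule AE_mp[OF _ AE_I2], clarify, intro conjI allI impI)
    fix x v :: "real ^ 'n ^ 'N" assume generic: "generic_velocities v"
    show "\<exists>X V P. sticky_evolution r0 x v X V P" by (rule sticky_evolution_exists)
    fix X V P assume "sticky_evolution r0 x v X V P"
    from concl[OF generic this]
    show "\<exists>T\<ge>0. \<forall>t\<ge>T. P t = {UNIV}"
      "((\<lambda>t. Max (range (\<lambda>(i, j). norm (V t $ i - V t $ j)))) \<longlongrightarrow> 0) at_top"
      by blast+
  qed
qed

end
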